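(* For every $n\ge 1$, the semigroup $\mathcal{ODCT}_n$ is $\mathcal{J}$-trivial, i.e. Green's relation $\mathcal{J}$ on $\mathcal{ODCT}_n$ is the equality relation.
   Context: $[n]=\{1,2,\ldots,n\}$ with its usual order. Maps are written on the right of their arguments. $\mathcal{ODCT}_n$ is the semigroup (under composition, $x(\alpha\beta)=(x\alpha)\beta$) of all maps $\alpha:[n]\to[n]$ that are contractions ($|x\alpha-y\alpha|\le|x-y|$ for all $x,y\in[n]$), order-preserving ($x\le y\Rightarrow x\alpha\le y\alpha$) and order-decreasing ($x\alpha\le x$ for all $x\in[n]$). Green's relation $\mathcal{J}$ on a semigroup $S$: $a\,\mathcal{J}\,b$ iff $S^1aS^1=S^1bS^1$. *)

theory Defs
  imports Main "HOL-Library.FuncSet"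
begin

text \<open>
  A semigroup is given by a carrier set \<open>S\<close> and a binary operation \<open>m\<close> that is closed and
  associative on \<open>S\<close>; only the values of \<open>m\<close> on \<open>S\<close> matter.
\<close>

definition is_semigroup :: "'a set \<Rightarrow> ('a \<Rightarrow> 'a \<Rightarrow> 'a) \<Rightarrow> bool" where
  "is_semigroup S m \<longleftrightarrow>
     (\<forall>x\<in>S. \<forall>y\<in>S. m x y \<in> S) \<and>
     (\<forall>x\<in>S. \<forall>y\<in>S. \<forall>z\<in>S. m (m x y) z = m x (m y z))"

definition has_identity :: "'a set \<Rightarrow> ('a \<Rightarrow> 'a \<Rightarrow> 'a) \<Rightarrow> bool" where
  "has_identity S m \<longleftrightarrow> (\<exists>e\<in>S. \<forall>x\<in>S. m e x = x \<and> m x e = x)"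

text \<open>
  The monoid \<open>S\<^sup>1\<close> lives in the option type: \<open>S\<close> is embedded by \<open>Some\<close>, and \<open>None\<close> is the
  identity that is adjoined only when \<open>S\<close> has none.
\<close>

definition carrier1 :: "'a set \<Rightarrow> ('a \<Rightarrow> 'a \<Rightarrow> 'a) \<Rightarrow> 'a option set" where
  "carrier1 S m = (if has_identity S m then Some ` S else insert None (Some ` S))"

fun mult1 :: "('a \<Rightarrow> 'a \<Rightarrow> 'a) \<Rightarrow> 'a option \<Rightarrow> 'a option \<Rightarrow> 'a option" where
  "mult1 m None y = y"
| "mult1 m (Some x) None = Some x"
| "mult1 m (Some x) (Some y) = Some (m x y)"

definition principal_ideal1 :: "'a set \<Rightarrow> ('a \<Rightarrow> 'a \<Rightarrow> 'a) \<Rightarrow> 'a \<Rightarrow> 'a option set" where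
  "principal_ideal1 S m a =
     {mult1 m (mult1 m x (Some a)) y | x y. x \<in> carrier1 S m \<and> y \<in> carrier1 S m}"

definition green_J :: "'a set \<Rightarrow> ('a \<Rightarrow> 'a \<Rightarrow> 'a) \<Rightarrow> ('a \<times> 'a) set" where
  "green_J S m =
     {(a, b). a \<in> S \<and> b \<in> S \<and> principal_ideal1 S m a = principal_ideal1 S m b}"

text \<open>
  A map \<open>[n] \<rightarrow> [n]\<close> is an extensional function on \<open>{1..n}\<close>, so that equality of elements is
  equality of maps. Distances are taken in \<open>int\<close> because subtraction on \<open>nat\<close> truncates.
\<close>

definition ODCT :: "nat \<Rightarrow> (nat \<Rightarrow> nat) set" where
  "ODCT n = {\<alpha> \<in> {1..n} \<rightarrow>\<^sub>E {1..n}.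
     (\<forall>x\<in>{1..n}. \<forall>y\<in>{1..n}. \<bar>int (\<alpha> x) - int (\<alpha> y)\<bar> \<le> \<bar>int x - int y\<bar>) \<and>
     mono_on {1..n} \<alpha> \<and>
     (\<forall>x\<in>{1..n}. \<alpha> x \<le> x)}"

text \<open>Maps act on the right: \<open>x (\<alpha> \<beta>) = (x \<alpha>) \<beta>\<close>, i.e. \<open>\<alpha>\<close> is applied first.\<close>

definition rcomp :: "nat \<Rightarrow> (nat \<Rightarrow> nat) \<Rightarrow> (nat \<Rightarrow> nat) \<Rightarrow> nat \<Rightarrow> nat" where
  "rcomp n \<alpha> \<beta> = compose {1..n} \<beta> \<alpha>"

lemma rcomp_in_ODCT:
  assumes a: "\<alpha> \<in> ODCT n" and b: "\<beta> \<in> ODCT n"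
  shows "rcomp n \<alpha> \<beta> \<in> ODCT n"
proof -
  have maps: "\<alpha> x \<in> {1..n}" "\<beta> x \<in> {1..n}" if "x \<in> {1..n}" for x
    using a b that unfolding ODCT_def by blast+
  have val: "rcomp n \<alpha> \<beta> x = \<beta> (\<alpha> x)" if "x \<in> {1..n}" for x
    using that by (simp add: rcomp_def compose_def)
  have "rcomp n \<alpha> \<beta> \<in> {1..n} \<rightarrow>\<^sub>E {1..n}"
    using maps by (auto simp: rcomp_def compose_def PiE_def extensional_def)
  moreover have "\<bar>int (rcomp n \<alpha> \<beta> x) - int (rcomp n \<alpha> \<beta> y)\<bar> \<le> \<bar>int x - int y\<bar>"
    if xy: "x \<in> {1..n}" "y \<in> {1..n}" for x y
  proof -
    have "\<bar>int (\<beta> (\<alpha> x)) - int (\<beta> (\<alpha> y))\<bar> \<le> \<bar>int (\<alpha> x) - int (\<alpha> y)\<bar>"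
      using b maps(1)[OF xy(1)] maps(1)[OF xy(2)] unfolding ODCT_def by blast
    also have "\<dots> \<le> \<bar>int x - int y\<bar>"
      using a xy unfolding ODCT_def by blast
    finally show ?thesis using val xy by simp
  qed
  moreover have "mono_on {1..n} (rcomp n \<alpha> \<beta>)"
  proof (rule mono_onI)
    fix x y assume xy: "x \<in> {1..n}" "y \<in> {1..n}" "x \<le> y"
    have ma: "mono_on {1..n} \<alpha>" and mb: "mono_on {1..n} \<beta>"
      using a b unfolding ODCT_def by blast+
    have "\<beta> (\<alpha> x) \<le> \<beta> (\<alpha> y)"
      using mono_onD[OF mb maps(1)[OF xy(1)] maps(1)[OF xy(2)]] mono_onD[OF ma xy] by blast
    then show "rcomp n \<alpha> \<beta> x \<le> rcomp n \<alpha> \<beta> y" using val xy by simp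
  qed
  moreover have "rcomp n \<alpha> \<beta> x \<le> x" if x: "x \<in> {1..n}" for x
  proof -
    have "\<beta> (\<alpha> x) \<le> \<alpha> x" using b maps(1)[OF x] unfolding ODCT_def by blast
    also have "\<dots> \<le> x" using a x unfolding ODCT_def by blast
    finally show ?thesis using val x by simp
  qed
  ultimately show ?thesis unfolding ODCT_def by blast
qed

lemma is_semigroup_ODCT: "is_semigroup (ODCT n) (rcomp n)"
proof -
  have "rcomp n (rcomp n \<alpha> \<beta>) \<gamma> = rcomp n \<alpha> (rcomp n \<beta> \<gamma>)" if "\<alpha> \<in> ODCT n" for \<alpha> \<beta> \<gamma>
  proof -
    have "\<alpha> x \<in> {1..n}" if "x \<in> {1..n}" for x
      using \<open>\<alpha> \<in> ODCT n\<close> that unfolding ODCT_def by blast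
    then show ?thesis by (intro ext) (auto simp: rcomp_def compose_def)
  qed
  then show ?thesis unfolding is_semigroup_def using rcomp_in_ODCT by blast
qed

end

theory Submission
  imports Defs
begin

text \<open>
  The idea is to compare maps pointwise. In a product \<open>\<alpha> \<beta>\<close> the map \<open>\<beta>\<close> is applied to a
  value of \<open>\<alpha>\<close> and can only lower it, so \<open>\<alpha> \<beta>\<close> lies below \<open>\<alpha>\<close>; and since \<open>x \<alpha> \<le> x\<close> and \<open>\<beta>\<close>
  preserves the order, \<open>x (\<alpha> \<beta>) \<le> x \<beta>\<close>, so \<open>\<alpha> \<beta>\<close> also lies below \<open>\<beta>\<close>
  (\<open>rcomp_le_left\<close>, \<open>rcomp_le_right\<close>). Hence every element of the
  principal ideal of \<open>\<alpha>\<close> lies below \<open>\<alpha>\<close>, and two maps that generate the same ideal lie below each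
  other and coincide. Only the order enters this second half of the argument, so it is carried out in
  any semigroup with a partial order in which products lie below their factors
  (\<open>green_J_trivial_if_mult_decreasing\<close>).
\<close>

text \<open>
  The case distinction behind \<open>carrier1\<close> is harmless here: either an identity of \<open>S\<close> or the
  adjoined one can serve as both multipliers.
\<close>

lemma generator_in_principal_ideal1:
  assumes "a \<in> S"
  shows "Some a \<in> principal_ideal1 S m a"
proof (cases "has_identity S m")
  case True
  then obtain e where e: "e \<in> S" "m e a = a" "m a e = a"
    using assms unfolding has_identity_def by blast
  then have "Some a = mult1 m (mult1 m (Some e) (Some a)) (Some e)" by simp
  moreover have "Some e \<in> carrier1 S m"
    using e(1) True by (simp add: carrier1_def)
  ultimately show ?thesis unfolding principal_ideal1_def by blast
next
  case False
  have "Some a = mult1 m (mult1 m None (Some a)) None" by simp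
  moreover have "None \<in> carrier1 S m"
    using False by (simp add: carrier1_def)
  ultimately show ?thesis unfolding principal_ideal1_def by blast
qed

lemma carrier1_cases:
  assumes "x \<in> carrier1 S m"
  obtains "x = None" | s where "x = Some s" "s \<in> S"
  using assms unfolding carrier1_def by (auto split: if_splits)

text \<open>
  Multiplying on either side only moves down, so the generator is the largest element of its
  principal ideal; such an element is unique, which makes the generator recoverable from the ideal.
\<close>

lemma green_J_trivial_if_mult_decreasing:
  fixes le :: "'a \<Rightarrow> 'a \<Rightarrow> bool"
  assumes sg: "is_semigroup S m"
    and refl: "\<And>a. a \<in> S \<Longrightarrow> le a a"
    and trans: "\<And>a b c. a \<in> S \<Longrightarrow> b \<in> S \<Longrightarrow> c \<in> S \<Longrightarrow> le a b \<Longrightarrow> le b c \<Longrightarrow> le a c"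
    and antisym: "\<And>a b. a \<in> S \<Longrightarrow> b \<in> S \<Longrightarrow> le a b \<Longrightarrow> le b a \<Longrightarrow> a = b"
    and left: "\<And>a b. a \<in> S \<Longrightarrow> b \<in> S \<Longrightarrow> le (m a b) a"
    and right: "\<And>a b. a \<in> S \<Longrightarrow> b \<in> S \<Longrightarrow> le (m a b) b"
  shows "green_J S m = Id_on S"
proof -
  have closed: "m a b \<in> S" if "a \<in> S" "b \<in> S" for a b
    using sg that unfolding is_semigroup_def by blast
  have below: "le b a" if a: "a \<in> S" and b: "Some b \<in> principal_ideal1 S m a" for a b
  proof -
    obtain x y where x: "x \<in> carrier1 S m" and y: "y \<in> carrier1 S m"
      and eq: "Some b = mult1 m (mult1 m x (Some a)) y"
      using b unfolding principal_ideal1_def by blast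
    obtain c where c: "mult1 m x (Some a) = Some c" "c \<in> S" "le c a"
      using x by (cases rule: carrier1_cases) (auto intro: a refl right closed)
    from y have "b \<in> S \<and> le b c"
      using eq c by (cases rule: carrier1_cases) (auto intro: refl left closed)
    then show ?thesis using trans a c by blast
  qed
  have "a = b"
    if "a \<in> S" "b \<in> S" "principal_ideal1 S m a = principal_ideal1 S m b" for a b
    using that antisym below generator_in_principal_ideal1 by metis
  then show ?thesis unfolding green_J_def by auto
qed

lemma ODCT_apply:
  assumes "\<alpha> \<in> ODCT n" "x \<in> {1..n}"
  shows "\<alpha> x \<in> {1..n}" "\<alpha> x \<le> x"
  using assms unfolding ODCT_def by blast+

lemma rcomp_le_left:
  assumes "\<alpha> \<in> ODCT n" "\<beta> \<in> ODCT n" "x \<in> {1..n}"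
  shows "rcomp n \<alpha> \<beta> x \<le> \<alpha> x"
  using ODCT_apply(2)[OF assms(2) ODCT_apply(1)[OF assms(1,3)]] assms(3)
  by (simp add: rcomp_def compose_def)

lemma rcomp_le_right:
  assumes "\<alpha> \<in> ODCT n" "\<beta> \<in> ODCT n" "x \<in> {1..n}"
  shows "rcomp n \<alpha> \<beta> x \<le> \<beta> x"
proof -
  have "mono_on {1..n} \<beta>" using assms(2) unfolding ODCT_def by blast
  from mono_onD[OF this ODCT_apply(1)[OF assms(1,3)] assms(3) ODCT_apply(2)[OF assms(1,3)]]
  show ?thesis using assms(3) by (simp add: rcomp_def compose_def)
qed

theorem theorem3:
  fixes n :: nat
  assumes "n \<ge> 1"
  shows "green_J (ODCT n) (rcomp n) = Id_on (ODCT n)"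
proof (rule green_J_trivial_if_mult_decreasing
    [where le = "\<lambda>\<alpha> \<beta>. \<forall>x\<in>{1..n}. \<alpha> x \<le> \<beta> x", OF is_semigroup_ODCT])
  fix \<alpha> \<beta> assume ab: "\<alpha> \<in> ODCT n" "\<beta> \<in> ODCT n"
  show "\<forall>x\<in>{1..n}. rcomp n \<alpha> \<beta> x \<le> \<alpha> x" using rcomp_le_left[OF ab] by blast
  show "\<forall>x\<in>{1..n}. rcomp n \<alpha> \<beta> x \<le> \<beta> x" using rcomp_le_right[OF ab] by blast
  assume le: "\<forall>x\<in>{1..n}. \<alpha> x \<le> \<beta> x" "\<forall>x\<in>{1..n}. \<beta> x \<le> \<alpha> x"
  have "\<alpha> \<in> {1..n} \<rightarrow>\<^sub>E {1..n}" "\<beta> \<in> {1..n} \<rightarrow>\<^sub>E {1..n}"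
    using ab unfolding ODCT_def by blast+
  then show "\<alpha> = \<beta>"
    by (rule PiE_ext) (use le in \<open>auto intro: antisym\<close>)
qed (auto intro: order_trans)

end
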